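(* Let $A \in \mathbb{C}^{n\times n}$ be Hermitian, let $\boldsymbol{x}^{(0)} \in \mathbb{C}^n$ with $\|\boldsymbol{x}^{(0)}\| = 1$, and let $(\boldsymbol{x}^{(k)})_{k\ge 0}$ be the sequence of vectors generated by the Projected Rayleigh Quotient Iteration (PRQI) for $A$ started at $\boldsymbol{x}^{(0)}$ with scaling factors $(\gamma^{(k)})_{k\ge 0}$. Let $\mu^{(k)} = (\boldsymbol{x}^{(k)})^\ast A \boldsymbol{x}^{(k)}$ for $k \ge 0$. Label the eigenvalues $\lambda_1,\dots,\lambda_n$ of $A$ (counted with multiplicity, with corresponding orthonormal eigenvectors $\boldsymbol{v}_1,\dots,\boldsymbol{v}_n$) such that $$|\lambda_1 - \mu^{(0)}| < |\lambda_2 - \mu^{(0)}| \le \cdots \le |\lambda_n - \mu^{(0)}|.$$ Let $q \in \{0,1\}$ and suppose that there is a constant $C_\gamma > 0$ such that $$0 < \gamma^{(k)} \le C_\gamma \tan^{1+q}\big(\theta(\boldsymbol{x}^{(k)}, \boldsymbol{v}_1)\big) \quad \text{for all } k \ge 0.$$ Suppose further that there exists a constant $c > 0$ such that $$\tan\big(\theta(\boldsymbol{x}^{(0)}, \boldsymbol{v}_1)\big) \le c \le \left(\frac{|\lambda_1 - \lambda_2|}{2\,(\|A - \lambda_1 I\| + C_\gamma)}\right)^{1/(1+q)}.$$ Then the next PRQI iterate $\boldsymbol{x}^{(1)}$ satisfies $$\tan\big(\theta(\boldsymbol{x}^{(1)}, \boldsymbol{v}_1)\big) \le 2\,\frac{\|A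 - \lambda_1 I\| + C_\gamma}{|\lambda_1 - \lambda_2|}\,\tan^{2+q}\big(\theta(\boldsymbol{x}^{(0)}, \boldsymbol{v}_1)\big) \le c,$$ i.e., in this sense PRQI is locally quadratically convergent (if $q=0$) or locally cubically convergent (if $q=1$).
   Context: $\|\cdot\|$ is the Euclidean norm on $\mathbb{C}^n$ and the induced (spectral) matrix norm; $\ast$ denotes conjugate transpose; $i$ is the imaginary unit; $n \ge 2$. For nonzero $\boldsymbol{u}, \boldsymbol{w} \in \mathbb{C}^n$ the angle is $$\theta(\boldsymbol{u},\boldsymbol{w}) = \arccos\left(\frac{|\boldsymbol{u}^\ast \boldsymbol{w}|}{\|\boldsymbol{u}\|\,\|\boldsymbol{w}\|}\right) \in [0,\pi/2],$$ with the convention $\tan(\pi/2) = +\infty$. Projected Rayleigh Quotient Iteration (PRQI): given $\boldsymbol{x}^{(0)}$ with $\|\boldsymbol{x}^{(0)}\|=1$, for $k = 0,1,2,\dots$ set $\mu^{(k)} = (\boldsymbol{x}^{(k)})^\ast A \boldsymbol{x}^{(k)} \in \mathbb{R}$, choose a real scaling factor $\gamma^{(k)} > 0$ (which may depend on the iterates $\boldsymbol{x}^{(0)},\dots,\boldsymbol{x}^{(k)}$), solve $$\big[A - (\mu^{(k)} - i\gamma^{(k)}) I\big]\boldsymbol{z}^{(k+1)} = \boldsymbol{x}^{(k)}$$ for $\boldsymbol{z}^{(k+1)}$, and set $\boldsymbol{x}^{(k+1)} = \boldsymbol{z}^{(k+1)}/\|\boldsymbol{z}^{(k+1)}\|$.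 The system is uniquely solvable because $A$ is Hermitian and $\gamma^{(k)}>0$. *)

theory Defs
  imports "HOL-Analysis.Analysis"
begin

text \<open>The instance \<^typ>\<open>complex ^ 'n\<close> carries the Euclidean norm, but its library inner product is
  the real one. The complex one is conjugate-linear in the first argument: \<open>cinner u w = u\<^sup>* w\<close>.\<close>

definition cinner :: "complex ^ 'n \<Rightarrow> complex ^ 'n \<Rightarrow> complex" where
  "cinner u w = (\<Sum>i\<in>UNIV. cnj (u $ i) * w $ i)"

definition conj_transpose :: "complex ^ 'n ^ 'm \<Rightarrow> complex ^ 'm ^ 'n" where
  "conj_transpose A = (\<chi> i j. cnj (A $ j $ i))"

definition hermitian :: "complex ^ 'n ^ 'n \<Rightarrow> bool" where
  "hermitian A \<longleftrightarrow> conj_transpose A = A"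

abbreviation spectral_norm :: "complex ^ 'n ^ 'm \<Rightarrow> real" where
  "spectral_norm A \<equiv> onorm (\<lambda>x. A *v x)"

text \<open>Only meaningful for nonzero arguments.\<close>

definition angle :: "complex ^ 'n \<Rightarrow> complex ^ 'n \<Rightarrow> real" where
  "angle u w = arccos (norm (cinner u w) / (norm u * norm w))"

text \<open>The convention \<open>tan (\<pi>/2) = +\<infinity>\<close> (in the library, \<open>tan (pi/2) = 0\<close>). Only used on \<open>[0, \<pi>/2]\<close>.\<close>

definition tan_ext :: "real \<Rightarrow> ereal" where
  "tan_ext t = (if t = pi / 2 then \<infinity> else ereal (tan t))"

text \<open>For Hermitian \<open>A\<close> the number \<open>x\<^sup>* A x\<close> is real, so taking the real part loses nothing; see
  \<open>of_real_rayleigh\<close> below.\<close>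

definition rayleigh :: "complex ^ 'n ^ 'n \<Rightarrow> complex ^ 'n \<Rightarrow> real" where
  "rayleigh A x = Re (cinner x (A *v x))"

lemma of_real_rayleigh:
  assumes "hermitian A"
  shows "complex_of_real (rayleigh A x) = cinner x (A *v x)"
proof -
  have A: "cnj (A $ i $ j) = A $ j $ i" for i j
  proof -
    have "cnj (A $ i $ j) = conj_transpose A $ j $ i"
      by (simp add: conj_transpose_def)
    then show ?thesis
      using assms by (simp add: hermitian_def)
  qed
  have "cnj (cinner x (A *v x)) = (\<Sum>i\<in>UNIV. \<Sum>j\<in>UNIV. x $ i * (A $ j $ i * cnj (x $ j)))"
    by (simp only: cinner_def matrix_vector_mult_def sum_distrib_left A vec_lambda_beta cnj_sum
        complex_cnj_mult complex_cnj_cnj)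
  also have "\<dots> = (\<Sum>j\<in>UNIV. \<Sum>i\<in>UNIV. x $ i * (A $ j $ i * cnj (x $ j)))"
    by (rule sum.swap)
  also have "\<dots> = cinner x (A *v x)"
    by (simp add: cinner_def matrix_vector_mult_def sum_distrib_left mult_ac)
  finally show ?thesis
    unfolding rayleigh_def by (simp add: Reals_cnj_iff)
qed

text \<open>\<open>x\<close> is a sequence of iterates of the projected Rayleigh quotient iteration for \<open>A\<close>, started at
  \<open>x 0\<close>, with scaling factors \<open>\<gamma>\<close>. As the statement is about one run of the iteration, a scaling
  factor that depends on the iterates so far is just a real number for each step.\<close>

definition PRQI ::
    "complex ^ 'n ^ 'n \<Rightarrow> (nat \<Rightarrow> real) \<Rightarrow> (nat \<Rightarrow> complex ^ 'n) \<Rightarrow> bool" where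
  "PRQI A \<gamma> x \<longleftrightarrow>
     norm (x 0) = 1 \<and>
     (\<forall>k. \<gamma> k > 0 \<and>
       (\<exists>z. (A - mat (complex_of_real (rayleigh A (x k)) - \<i> * complex_of_real (\<gamma> k))) *v z = x k \<and>
            x (Suc k) = z /\<^sub>R norm z))"

text \<open>Eigenvalues \<open>ev 1, \<dots>, ev n\<close> with orthonormal eigenvectors \<open>v 1, \<dots>, v n\<close>, where \<open>n = CARD('n)\<close>
  is the full dimension, so that every eigenvalue is listed with its multiplicity.\<close>

definition orthonormal_eigensystem ::
    "complex ^ 'n ^ 'n \<Rightarrow> (nat \<Rightarrow> real) \<Rightarrow> (nat \<Rightarrow> complex ^ 'n) \<Rightarrow> bool" where
  "orthonormal_eigensystem A ev v \<longleftrightarrow>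
     (\<forall>i\<in>{1..CARD('n)}. A *v v i = complex_of_real (ev i) *s v i) \<and>
     (\<forall>i\<in>{1..CARD('n)}. \<forall>j\<in>{1..CARD('n)}. cinner (v i) (v j) = (if i = j then 1 else 0))"

end

theory Submission
  imports Defs
begin

text \<open>Write \<open>a i = |v i\<^sup>* x|\<close> for a unit vector \<open>x\<close>, so that \<open>tan \<theta> = sqrt (\<Sum>i\<ge>2. (a i)\<^sup>2) / a 1\<close>. Solving the shifted
  system with shift \<open>\<sigma> = \<mu> - \<i> \<gamma>\<close> divides each \<open>a i\<close> by \<open>|\<lambda> i - \<sigma>|\<close>, which multiplies the tangent by at
  most \<open>|\<lambda> 1 - \<sigma>| / |\<lambda> 2 - \<sigma>|\<close>. The denominator is at least \<open>|\<lambda> 1 - \<lambda> 2| / 2\<close>, since \<open>\<mu>\<close> is closer to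
  \<open>\<lambda> 1\<close> than to \<open>\<lambda> 2\<close>. The numerator is at most \<open>|\<lambda> 1 - \<mu>| + \<gamma>\<close>, where the Rayleigh quotient error
  \<open>|\<lambda> 1 - \<mu>|\<close> is at most \<open>\<parallel>A - \<lambda> 1 I\<parallel> sin\<^sup>2 \<theta>\<close>.\<close>

section \<open>Complex inner product and expansion in an orthonormal basis\<close>

lemma cinner_commute: "cinner u w = cnj (cinner w u)"
  by (simp add: cinner_def mult.commute)

lemma cinner_self: "cinner u u = complex_of_real ((norm u)\<^sup>2)"
  by (simp add: cinner_def norm_vec_def L2_set_def sum_nonneg complex_norm_square mult.commute
      del: of_real_power)

lemma norm_eq_1_if_cinner_self:
  assumes "cinner u u = 1"
  shows "norm u = 1"
proof -
  have "complex_of_real ((norm u)\<^sup>2) = 1"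
    using assms by (simp only: cinner_self)
  then have "(norm u)\<^sup>2 = 1"
    by (simp only: of_real_eq_1_iff)
  then show ?thesis
    by (simp add: abs_square_eq_1)
qed

lemma cinner_diff_right: "cinner u (w - y) = cinner u w - cinner u y"
  by (simp add: cinner_def right_diff_distrib sum_subtractf)

lemma cinner_scale_left: "cinner (a *s u) w = cnj a * cinner u w"
  by (simp add: cinner_def sum_distrib_left mult_ac)

lemma cinner_scale_right: "cinner u (a *s w) = a * cinner u w"
  by (simp add: cinner_def sum_distrib_left mult_ac)

lemma cinner_adjoint: "cinner u (A *v w) = cinner (conj_transpose A *v u) w"
proof -
  have "cinner u (A *v w) = (\<Sum>i\<in>UNIV. \<Sum>j\<in>UNIV. cnj (u $ i) * (A $ i $ j * w $ j))"
    by (simp add: cinner_def matrix_vector_mult_def sum_distrib_left)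
  also have "\<dots> = (\<Sum>j\<in>UNIV. \<Sum>i\<in>UNIV. cnj (u $ i) * (A $ i $ j * w $ j))"
    by (rule sum.swap)
  also have "\<dots> = cinner (conj_transpose A *v u) w"
    by (simp add: cinner_def matrix_vector_mult_def conj_transpose_def sum_distrib_left mult_ac)
  finally show ?thesis .
qed

lemma mat_mult_vec: "mat a *v w = a *s (w :: 'a::comm_semiring_1 ^ 'n)"
  by (simp add: vec_eq_iff matrix_vector_mult_def mat_def if_distrib if_distribR cong: if_cong)

text \<open>The matrix \<open>U\<close> whose rows are the conjugated basis vectors maps a vector to
  its coefficients. Orthonormality makes \<open>U\<close> unitary, and unitary maps preserve the
  inner product.\<close>

lemma parseval:
  fixes v :: "nat \<Rightarrow> complex ^ 'n"
  assumes orth: "\<forall>i\<in>{1..CARD('n)}. \<forall>j\<in>{1..CARD('n)}.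
    cinner (v i) (v j) = (if i = j then 1 else 0)"
  shows "cinner x y = (\<Sum>i = 1..CARD('n). cnj (cinner (v i) x) * cinner (v i) y)"
proof -
  \<comment> \<open>The bijection \<open>f\<close> relabels the basis by the index type
    \<open>'n\<close>, so that \<open>U\<close> is a square matrix.\<close>
  obtain f :: "'n \<Rightarrow> nat" where f: "bij_betw f UNIV {1..CARD('n)}"
    by (metis card_atLeastAtMost diff_Suc_1 finite finite_atLeastAtMost finite_same_card_bij)
  have f_range: "f i \<in> {1..CARD('n)}" for i
    using f bij_betwE by blast
  have f_inj: "f i = f j \<longleftrightarrow> i = j" for i j
    using f by (auto simp: bij_betw_def inj_on_def)
  define U where "U = (\<chi> j. \<chi> i. cnj (v (f j) $ i))"
  have U_mult: "(U *v w) $ j = cinner (v (f j)) w" for w j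
    by (simp add: U_def matrix_vector_mult_def cinner_def)
  have "U ** conj_transpose U = mat 1"
    using orth f_range
    by (simp add: vec_eq_iff matrix_matrix_mult_def U_def conj_transpose_def cinner_def mat_def f_inj)
  \<comment> \<open>For a square matrix a right inverse is also a left inverse.\<close>
  then have "conj_transpose U ** U = mat 1"
    by (simp add: matrix_left_right_inverse)
  then have "cinner x y = cinner x (conj_transpose U *v (U *v y))"
    by (simp add: matrix_vector_mul_assoc)
  also have "\<dots> = cinner (U *v x) (U *v y)"
    by (simp add: cinner_adjoint) (simp add: conj_transpose_def)
  also have "\<dots> = (\<Sum>j\<in>UNIV. cnj (cinner (v (f j)) x) * cinner (v (f j)) y)"
    by (simp add: cinner_def[of "U *v x"] U_mult)
  also have "\<dots> = (\<Sum>i = 1..CARD('n). cnj (cinner (v i) x) * cinner (v i) y)"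
    by (rule sum.reindex_bij_betw[OF f])
  finally show ?thesis .
qed

lemma norm_square_parseval:
  fixes v :: "nat \<Rightarrow> complex ^ 'n"
  assumes "\<forall>i\<in>{1..CARD('n)}. \<forall>j\<in>{1..CARD('n)}.
    cinner (v i) (v j) = (if i = j then 1 else 0)"
  shows "(norm x)\<^sup>2 = (\<Sum>i = 1..CARD('n). (cmod (cinner (v i) x))\<^sup>2)"
proof -
  have "complex_of_real ((norm x)\<^sup>2) = (\<Sum>i = 1..CARD('n). cnj (cinner (v i) x) * cinner (v i) x)"
    using parseval[OF assms, of x x] by (simp only: cinner_self)
  also have "\<dots> = complex_of_real (\<Sum>i = 1..CARD('n). (cmod (cinner (v i) x))\<^sup>2)"
    by (simp only: of_real_sum complex_norm_square mult.commute)
  finally show ?thesis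
    by (simp only: of_real_eq_iff)
qed

section \<open>Angles and their tangents\<close>

lemma angle_scaleR_left:
  assumes "r > 0"
  shows "angle (r *\<^sub>R u) w = angle u w"
proof -
  have "cinner (r *\<^sub>R u) w = complex_of_real r * cinner u w"
    by (simp add: cinner_def sum_distrib_left scaleR_conv_of_real[where 'a = complex] mult_ac)
  then show ?thesis
    using assms by (simp add: angle_def norm_mult)
qed

text \<open>Here \<open>s\<close> stands for the length of the part of \<open>u\<close> orthogonal
  to \<open>w\<close>, so the tangent is opposite over adjacent side. The orthogonal case has no
  adjacent side and takes the conventional value.\<close>

lemma tan_ext_angle:
  assumes w: "norm w = 1" and u: "u \<noteq> 0" and s: "s \<ge> 0"
    and pyth: "(norm u)\<^sup>2 = (cmod (cinner w u))\<^sup>2 + s\<^sup>2"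
  shows "tan_ext (angle u w) =
    (if cinner w u = 0 then \<infinity> else ereal (s / cmod (cinner w u)))"
proof -
  define p where "p = cmod (cinner w u) / norm u"
  have ang: "angle u w = arccos p"
    by (simp add: angle_def p_def w cinner_commute[of u w])
  have nu: "norm u > 0"
    using u by simp
  have p0: "0 \<le> p"
    by (simp add: p_def)
  have "cmod (cinner w u) \<le> norm u"
    by (rule power2_le_imp_le) (simp_all add: pyth)
  then have p1: "p \<le> 1"
    using nu by (simp add: p_def divide_le_eq)
  have "1 - p\<^sup>2 = ((norm u)\<^sup>2 - (cmod (cinner w u))\<^sup>2) / (norm u)\<^sup>2"
    using nu by (simp add: p_def power_divide diff_divide_distrib)
  also have "\<dots> = (s / norm u)\<^sup>2"
    by (simp add: pyth power_divide)
  finally have "1 - p\<^sup>2 = (s / norm u)\<^sup>2" .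
  then have sin: "sin (arccos p) = s / norm u"
    using p0 p1 s nu by (simp add: sin_arccos)
  have cos: "cos (arccos p) = p"
    using p0 p1 by simp
  show ?thesis
  proof (cases "cinner w u = 0")
    case True
    then show ?thesis
      by (simp add: ang tan_ext_def p_def)
  next
    case False
    then have "p \<noteq> 0"
      using nu by (simp add: p_def)
    then have "arccos p \<noteq> pi / 2"
      using cos by (metis cos_pi_half)
    moreover have "tan (arccos p) = s / cmod (cinner w u)"
      unfolding tan_def sin cos using nu by (simp add: p_def)
    ultimately show ?thesis
      using False by (simp add: ang tan_ext_def)
  qed
qed

section \<open>Eigenvalues and the Rayleigh quotient\<close>

lemma hermitian_cinner_eigenvector:
  assumes "hermitian A" and "A *v w = complex_of_real l *s w"
  shows "cinner w (A *v y) = complex_of_real l * cinner w y"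
  using assms by (simp add: cinner_adjoint hermitian_def cinner_scale_left)

text \<open>The eigenvector \<open>w\<close> serves as a test vector for the operator norm: the
  shifted matrix stretches it by exactly \<open>\<bar>l - m\<bar>\<close>.\<close>

lemma abs_eigenvalue_diff_le_spectral_norm:
  assumes "norm w = 1" and "A *v w = complex_of_real l *s w"
  shows "\<bar>l - m\<bar> \<le> spectral_norm (A - mat (complex_of_real m))"
proof -
  have "(A - mat (complex_of_real m)) *v w = (l - m) *\<^sub>R w"
    using assms(2)
    by (simp add: matrix_vector_mult_diff_rdistrib mat_mult_vec vec_eq_iff scaleR_conv_of_real[where 'a = complex]
        left_diff_distrib)
  then have "norm ((A - mat (complex_of_real m)) *v w) = \<bar>l - m\<bar>"
    using assms(1) by simp
  moreover have "norm ((A - mat (complex_of_real m)) *v w)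
      \<le> spectral_norm (A - mat (complex_of_real m)) * norm w"
    by (rule onorm[OF matrix_vector_mul_bounded_linear])
  ultimately show ?thesis
    using assms(1) by simp
qed

text \<open>By Parseval the Rayleigh quotient is the mean of the eigenvalues with weights
  \<open>(cmod (cinner (v i) x))\<^sup>2\<close>, which sum to 1. Subtracting \<open>ev 1\<close>
  removes the first term, and the spectral norm bounds the other differences. The remaining weights
  sum to the squared sine of the angle to \<open>v 1\<close>.\<close>

lemma rayleigh_error_le:
  fixes A :: "complex ^ 'n ^ 'n" and v :: "nat \<Rightarrow> complex ^ 'n"
  assumes herm: "hermitian A" and eig: "orthonormal_eigensystem A ev v" and x: "norm x = 1"
  shows "\<bar>ev 1 - rayleigh A x\<bar> \<le> spectral_norm (A - mat (complex_of_real (ev 1)))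
    * (\<Sum>i = 2..CARD('n). (cmod (cinner (v i) x))\<^sup>2)"
proof -
  let ?N = "spectral_norm (A - mat (complex_of_real (ev 1)))"
  let ?a = "\<lambda>i. (cmod (cinner (v i) x))\<^sup>2"
  have orth: "\<forall>i\<in>{1..CARD('n)}. \<forall>j\<in>{1..CARD('n)}.
    cinner (v i) (v j) = (if i = j then 1 else 0)"
    using eig by (simp add: orthonormal_eigensystem_def)
  have Av: "A *v v i = complex_of_real (ev i) *s v i" if "i \<in> {1..CARD('n)}" for i
    using eig that by (simp add: orthonormal_eigensystem_def)
  have norm_v: "norm (v i) = 1" if "i \<in> {1..CARD('n)}" for i
    using orth that by (simp add: norm_eq_1_if_cinner_self)
  have "complex_of_real (rayleigh A x) = (\<Sum>i = 1..CARD('n). complex_of_real (ev i * ?a i))"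
    unfolding of_real_rayleigh[OF herm] parseval[OF orth, of x "A *v x"]
    by (intro sum.cong refl)
      (simp add: hermitian_cinner_eigenvector[OF herm Av] complex_norm_square mult_ac
        del: of_real_power)
  then have "rayleigh A x = (\<Sum>i = 1..CARD('n). ev i * ?a i)"
    by (simp only: of_real_sum[symmetric] of_real_eq_iff)
  moreover have "ev 1 = ev 1 * (\<Sum>i = 1..CARD('n). ?a i)"
    using norm_square_parseval[OF orth, of x] x by simp
  ultimately have "rayleigh A x - ev 1 = (\<Sum>i = 1..CARD('n). (ev i - ev 1) * ?a i)"
    by (simp add: left_diff_distrib sum_subtractf sum_distrib_left)
  also have "\<dots> = (\<Sum>i = 2..CARD('n). (ev i - ev 1) * ?a i)"
    by (intro sum.mono_neutral_right) (auto simp: numeral_2_eq_2 not_less_eq_eq le_Suc_eq)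
  finally have "\<bar>ev 1 - rayleigh A x\<bar> \<le> (\<Sum>i = 2..CARD('n). \<bar>(ev i - ev 1) * ?a i\<bar>)"
    by (simp add: abs_minus_commute)
  also have "\<dots> \<le> (\<Sum>i = 2..CARD('n). ?N * ?a i)"
    using abs_eigenvalue_diff_le_spectral_norm[OF norm_v Av, of _ "ev 1"]
    by (intro sum_mono) (simp add: abs_mult mult_right_mono)
  finally show ?thesis
    by (simp add: sum_distrib_left)
qed

section \<open>One iteration step and its effect on the tangent\<close>

theorem theorem3p2:
  fixes A :: "complex ^ 'n ^ 'n"
    and x v :: "nat \<Rightarrow> complex ^ 'n"
    and \<gamma> \<mu> ev :: "nat \<Rightarrow> real"
    and q :: nat
    and C\<^sub>\<gamma> c :: real
  assumes "CARD('n) \<ge> 2"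
    and "hermitian A"
    and "norm (x 0) = 1"
    and "PRQI A \<gamma> x"
    and "\<And>k. \<mu> k = rayleigh A (x k)"
    and "orthonormal_eigensystem A ev v"
    and "\<bar>ev 1 - \<mu> 0\<bar> < \<bar>ev 2 - \<mu> 0\<bar>"
    and "\<And>i j. 2 \<le> i \<Longrightarrow> i \<le> j \<Longrightarrow> j \<le> CARD('n) \<Longrightarrow> \<bar>ev i - \<mu> 0\<bar> \<le> \<bar>ev j - \<mu> 0\<bar>"
    and "q \<in> {0, 1}"
    and "C\<^sub>\<gamma> > 0"
    and "\<And>k. 0 < \<gamma> k"
    and "\<And>k. ereal (\<gamma> k) \<le> ereal C\<^sub>\<gamma> * tan_ext (angle (x k) (v 1)) ^ (1 + q)"
    and "c > 0"
    and "tan_ext (angle (x 0) (v 1)) \<le> ereal c"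
    and "c \<le> (\<bar>ev 1 - ev 2\<bar> / (2 * (spectral_norm (A - mat (complex_of_real (ev 1))) + C\<^sub>\<gamma>)))
                powr (1 / (1 + real q))"
  shows "tan_ext (angle (x 1) (v 1))
           \<le> ereal (2 * ((spectral_norm (A - mat (complex_of_real (ev 1))) + C\<^sub>\<gamma>) / \<bar>ev 1 - ev 2\<bar>))
                * tan_ext (angle (x 0) (v 1)) ^ (2 + q)
       \<and> ereal (2 * ((spectral_norm (A - mat (complex_of_real (ev 1))) + C\<^sub>\<gamma>) / \<bar>ev 1 - ev 2\<bar>))
             * tan_ext (angle (x 0) (v 1)) ^ (2 + q)
           \<le> ereal c"
proof -
  let ?I = "{2..CARD('n)}"
  define N where "N = spectral_norm (A - mat (complex_of_real (ev 1)))"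
  define D where "D = \<bar>ev 1 - ev 2\<bar>"
  define a where "a = (\<lambda>u. cmod (cinner (v 1) u))"
  define s where "s = (\<lambda>u. sqrt (\<Sum>i\<in>?I. (cmod (cinner (v i) u))\<^sup>2))"
  define t where "t = s (x 0) / a (x 0)"
  note card = assms(1) and herm = assms(2) and x0 = assms(3) and eig = assms(6)
  have orth: "\<forall>i\<in>{1..CARD('n)}. \<forall>j\<in>{1..CARD('n)}.
    cinner (v i) (v j) = (if i = j then 1 else 0)"
    using eig by (simp add: orthonormal_eigensystem_def)
  have Av: "A *v v i = complex_of_real (ev i) *s v i" if "i \<in> {1..CARD('n)}" for i
    using eig that by (simp add: orthonormal_eigensystem_def)
  have one: "1 \<in> {1..CARD('n)}"
    using card by simp
  have norm_v1: "norm (v 1) = 1"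
    using orth one by (simp add: norm_eq_1_if_cinner_self)
  have s_sq: "(s u)\<^sup>2 = (\<Sum>i\<in>?I. (cmod (cinner (v i) u))\<^sup>2)" and s_nonneg: "s u \<ge> 0" for u
    by (simp_all add: s_def sum_nonneg)
  have pyth: "(norm u)\<^sup>2 = (a u)\<^sup>2 + (s u)\<^sup>2" for u
    using card unfolding norm_square_parseval[OF orth] s_sq a_def
    by (subst sum.atLeast_Suc_atMost) (simp_all flip: numeral_2_eq_2)
  have tan_eq: "tan_ext (angle u (v 1)) = (if a u = 0 then \<infinity> else ereal (s u / a u))"
    if "u \<noteq> 0" for u
    using tan_ext_angle[OF norm_v1 that s_nonneg pyth[unfolded a_def]] by (simp add: a_def)

  have "x 0 \<noteq> 0"
    using x0 by auto
  \<comment> \<open>The finite bound \<open>c\<close> rules out the value \<infinity>, so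
    \<open>x 0\<close> is not orthogonal to \<open>v 1\<close> and the tangent is the real number
    \<open>t\<close>.\<close>
  then have a0: "a (x 0) \<noteq> 0" and t: "tan_ext (angle (x 0) (v 1)) = ereal t"
    using assms(14) tan_eq[of "x 0"] by (auto simp: t_def split: if_splits)
  have a_pos: "a (x 0) > 0"
    using a0 by (simp add: a_def)
  have t_nonneg: "t \<ge> 0"
    using a_pos s_nonneg by (simp add: t_def)
  have t_le: "t \<le> c"
    using assms(14) by (simp only: t ereal_less_eq)
  have gam: "\<gamma> 0 \<le> C\<^sub>\<gamma> * t ^ (1 + q)"
    using assms(12)[of 0] unfolding t by simp
  have gam_pos: "\<gamma> 0 > 0"
    by (rule assms(11))
  have mu: "\<mu> 0 = rayleigh A (x 0)"
    by (rule assms(5))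

  have N_nonneg: "N \<ge> 0"
    unfolding N_def by (rule onorm_pos_le[OF matrix_vector_mul_bounded_linear])
  have D_pos: "D > 0"
    using assms(7) by (auto simp: D_def)
  \<comment> \<open>This brings the Rayleigh quotient error to the same order in \<open>t\<close> as
    the bound on \<open>\<gamma> 0\<close>. As \<open>a (x 0)\<close> and \<open>s (x 0)\<close> are
    at most 1, the sine \<open>s (x 0)\<close> is at most \<open>t\<close>; then use
    \<open>(s (x 0))\<^sup>2 \<le> s (x 0)\<close> for \<open>q = 0\<close> and square for
    \<open>q = 1\<close>.\<close>
  have "(s (x 0))\<^sup>2 \<le> t ^ (1 + q)"
  proof -
    have sum_one: "(a (x 0))\<^sup>2 + (s (x 0))\<^sup>2 = 1"
      using pyth[of "x 0"] x0 by simp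
    have "(a (x 0))\<^sup>2 \<le> 1" "(s (x 0))\<^sup>2 \<le> 1"
      using sum_one zero_le_power2[of "a (x 0)"] zero_le_power2[of "s (x 0)"] by linarith+
    then have "a (x 0) \<le> 1" "s (x 0) \<le> 1"
      using a_pos s_nonneg[of "x 0"] by (simp_all add: abs_square_le_1)
    then have "s (x 0) \<le> t"
      using a_pos s_nonneg[of "x 0"] by (simp add: t_def le_divide_eq mult_left_le)
    moreover from this have "(s (x 0))\<^sup>2 \<le> t\<^sup>2"
      using s_nonneg by (rule power_mono)
    moreover have "(s (x 0))\<^sup>2 \<le> s (x 0)"
      using \<open>s (x 0) \<le> 1\<close> s_nonneg[of "x 0"] by (simp add: power2_eq_square mult_left_le)
    ultimately show ?thesis
      using assms(9) by (auto simp: power2_eq_square)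
  qed
  then have "\<bar>ev 1 - \<mu> 0\<bar> \<le> N * t ^ (1 + q)"
    using rayleigh_error_le[OF herm eig x0] N_nonneg
    by (simp only: mu N_def s_sq[symmetric]) (meson mult_left_mono order_trans)
  with gam have num: "\<bar>ev 1 - \<mu> 0\<bar> + \<gamma> 0 \<le> (N + C\<^sub>\<gamma>) * t ^ (1 + q)"
    by (simp add: distrib_right)

  define \<sigma> where "\<sigma> = complex_of_real (\<mu> 0) - \<i> * complex_of_real (\<gamma> 0)"
  obtain z where z: "(A - mat \<sigma>) *v z = x 0" and x1: "x 1 = z /\<^sub>R norm z"
    using assms(4) by (auto simp: PRQI_def \<sigma>_def mu)
  have z_nz: "z \<noteq> 0"
    using z \<open>x 0 \<noteq> 0\<close> by auto
  \<comment> \<open>Pair the linear system with \<open>v i\<close>, on which the shifted matrix acts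
    as a scalar.\<close>
  have coeff: "cmod (complex_of_real (ev i) - \<sigma>) * cmod (cinner (v i) z) = cmod (cinner (v i) (x 0))"
    if "i \<in> {1..CARD('n)}" for i
    unfolding z[symmetric] norm_mult[symmetric]
    by (simp add: matrix_vector_mult_diff_rdistrib mat_mult_vec cinner_diff_right
        cinner_scale_right hermitian_cinner_eigenvector[OF herm Av[OF that]] left_diff_distrib)
  have dist1: "cmod (complex_of_real (ev 1) - \<sigma>) \<le> (N + C\<^sub>\<gamma>) * t ^ (1 + q)"
  proof -
    have "complex_of_real (ev 1) - \<sigma>
        = complex_of_real (ev 1 - \<mu> 0) + \<i> * complex_of_real (\<gamma> 0)"
      by (simp add: \<sigma>_def)
    also have "cmod \<dots> \<le> \<bar>ev 1 - \<mu> 0\<bar> + \<gamma> 0"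
      using norm_triangle_ineq[of "complex_of_real (ev 1 - \<mu> 0)" "\<i> * complex_of_real (\<gamma> 0)"] gam_pos
      by (simp add: norm_mult del: of_real_diff)
    finally show ?thesis
      using num by linarith
  qed
  \<comment> \<open>The triangle inequality through \<open>\<mu> 0\<close> gives
    \<open>D < 2 * \<bar>ev 2 - \<mu> 0\<bar>\<close>; the ordering passes this on to every
    \<open>i \<ge> 2\<close>, and the imaginary part of the shift can only increase the
    modulus.\<close>
  have dist2: "D / 2 \<le> cmod (complex_of_real (ev i) - \<sigma>)" if "i \<in> ?I" for i
  proof -
    have "D / 2 \<le> \<bar>ev 2 - \<mu> 0\<bar>"
      using assms(7) abs_triangle_ineq4[of "ev 1 - \<mu> 0" "ev 2 - \<mu> 0"] by (simp add: D_def)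
    also have "\<dots> \<le> \<bar>ev i - \<mu> 0\<bar>"
      using assms(8)[of 2 i] that by simp
    also have "\<dots> \<le> cmod (complex_of_real (ev i) - \<sigma>)"
      using abs_Re_le_cmod[of "complex_of_real (ev i) - \<sigma>"] by (simp add: \<sigma>_def)
    finally show ?thesis .
  qed
  have az: "cmod (complex_of_real (ev 1) - \<sigma>) * a z = a (x 0)"
    using coeff[OF one] by (simp add: a_def)
  \<comment> \<open>If \<open>a z\<close> vanished, so would \<open>a (x 0)\<close>.\<close>
  with a_pos have az_pos: "a z > 0"
    by (auto simp: a_def intro: ccontr)
  \<comment> \<open>Compare squares, so that the bound can be checked coefficient by
    coefficient.\<close>
  have "D / 2 * s z \<le> s (x 0)"
  proof (rule power2_le_imp_le)
    have "(D / 2 * s z)\<^sup>2 = (\<Sum>i\<in>?I. (D / 2 * cmod (cinner (v i) z))\<^sup>2)"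
      unfolding power_mult_distrib s_sq sum_distrib_left ..
    also have "\<dots> \<le> (\<Sum>i\<in>?I. (cmod (cinner (v i) (x 0)))\<^sup>2)"
    proof (intro sum_mono power_mono)
      fix i assume i: "i \<in> ?I"
      then have "D / 2 * cmod (cinner (v i) z)
          \<le> cmod (complex_of_real (ev i) - \<sigma>) * cmod (cinner (v i) z)"
        by (intro mult_right_mono dist2) simp_all
      then show "D / 2 * cmod (cinner (v i) z) \<le> cmod (cinner (v i) (x 0))"
        using i coeff[of i] by simp
    qed (use D_pos in simp)
    finally show "(D / 2 * s z)\<^sup>2 \<le> (s (x 0))\<^sup>2"
      by (simp add: s_sq)
  qed (rule s_nonneg)
  also have "s (x 0) = t * a (x 0)"
    using a0 by (simp add: t_def)
  \<comment> \<open>The step from \<open>a (x 0)\<close> to \<open>a z\<close> costs the small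
    factor \<open>t ^ (1 + q)\<close>; with the \<open>t\<close> already present this gives the
    exponent \<open>2 + q\<close>.\<close>
  also have "\<dots> \<le> t * ((N + C\<^sub>\<gamma>) * t ^ (1 + q) * a z)"
    unfolding az[symmetric] using t_nonneg az_pos
    by (intro mult_left_mono mult_right_mono dist1) simp_all
  finally have "s z / a z \<le> 2 * ((N + C\<^sub>\<gamma>) / D) * t ^ (2 + q)"
    using az_pos D_pos by (simp add: field_simps)
  \<comment> \<open>Normalizing \<open>z\<close> leaves the angle unchanged.\<close>
  moreover have "tan_ext (angle (x 1) (v 1)) = ereal (s z / a z)"
    unfolding x1 using z_nz az_pos tan_eq[OF z_nz] by (simp add: angle_scaleR_left)
  ultimately have step: "tan_ext (angle (x 1) (v 1)) \<le> ereal (2 * ((N + C\<^sub>\<gamma>) / D) * t ^ (2 + q))"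
    by simp

  have NC: "N + C\<^sub>\<gamma> > 0"
    using N_nonneg assms(10) by simp
  \<comment> \<open>Raising the upper bound on \<open>c\<close> to the power \<open>1 + q\<close>
    cancels its root, so one step multiplies \<open>t\<close> by a factor of at most 1.\<close>
  have "t ^ (1 + q) \<le> c ^ (1 + q)"
    using t_le t_nonneg by (rule power_mono)
  also have "\<dots> = c powr (1 + real q)"
    using assms(13) powr_realpow[of c "1 + q"] by simp
  also have "\<dots> \<le> ((D / (2 * (N + C\<^sub>\<gamma>))) powr (1 / (1 + real q))) powr (1 + real q)"
    using assms(13,15) by (intro powr_mono2) (simp_all add: N_def D_def)
  also have "\<dots> = D / (2 * (N + C\<^sub>\<gamma>))"
    using D_pos NC by (simp add: powr_powr)
  finally have "2 * ((N + C\<^sub>\<gamma>) / D) * t ^ (1 + q) \<le> 1"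
    using D_pos NC by (simp add: field_simps)
  then have "2 * ((N + C\<^sub>\<gamma>) / D) * t ^ (1 + q) * t \<le> 1 * t"
    using t_nonneg by (rule mult_right_mono)
  then have "2 * ((N + C\<^sub>\<gamma>) / D) * t ^ (2 + q) \<le> c"
    using t_le by (simp add: mult_ac)
  with step show ?thesis
    unfolding t N_def D_def by simp
qed

end
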